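(* Let $\varepsilon>0$ and let $k\ge1$ be an integer. For a dataset $D=[x]$ of records $x_i\in[0,1]$ and $0\le j\le k$, let $\mu_j(D)=\sum_{i}x_i^j$ be the $j$-th order (unnormalized) moment, and let $\hat\mu(D)=(\hat\mu_0,\dots,\hat\mu_k)^\top$ be the output of the Bézier mechanism of degree $k$ with privacy budget $\varepsilon$ (defined in the context). Then for every dataset $D$ and every $0\le j\le k$, the mechanism that outputs $\hat\mu_j$ satisfies $$L(\hat\mu_j,\mu_j,D)=\frac{2}{\varepsilon^2\binom kj^2}\sum_{l=j}^k\binom lj^2\ \le\ \frac{2k}{\varepsilon^2}.$$ In particular $L(\hat\mu_k,\mu_k,D)=\frac2{\varepsilon^2}$, which matches the lower bound for estimation of the $k$-th unnormalized moment in the high-privacy regime: with $k$ fixed, as $\varepsilon\to0$, $$\inf_{\tilde\mu_k}\ \sup_{D}\ L(\tilde\mu_k,\mu_k,D)\ \ge\ \frac2{\varepsilon^2}(1-o(1)),$$ where the infimum is over all estimators $\tilde\mu_k$ of $\mu_k$ that are $\varepsilon$-differentially private in the add-remove model, and the supremum is over all datasets with records in $[0,1]$.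
   Context: A dataset is a finite collection (multiset) of $n\ge1$ records in $[0,1]$, of any size $n$. For a randomized estimator $\hat f$ of a real statistic $f$, $L(\hat f,f,D)=\mathbb E[(\hat f(D)-f(D))^2]$, the expectation being over the randomness of $\hat f$. Bézier mechanism of degree $k$: let $B_j(t)=\binom kj t^j(1-t)^{k-j}$ for $0\le j\le k$ (Bernstein basis) and let $A$ be the $(k+1)\times(k+1)$ Bézier matrix with $A_{j,l}=(-1)^{l-j}\binom kl\binom lj$ for $j\le l$ and $A_{j,l}=0$ for $j>l$ ($0\le j,l\le k$), which is invertible. Put $b_j=\sum_iB_j(x_i)$, $\tilde b_j=b_j+Z_j$ with $Z_0,\dots,Z_k$ independent $\mathrm{Lap}(1/\varepsilon)$ variables (density $\frac\varepsilon2e^{-\varepsilon|t|}$), and output $\hat\mu(D)=A^{-1}\tilde b$. A randomized estimator $\tilde\mu$ is $\varepsilon$-differentially private in the add-remove model if $\Pr[\tilde\mu(D)\in S]\le e^\varepsilon\Pr[\tilde\mu(D')\in S]$ for all measurable $S$ and all datasets $D,D'$ of which one is obtained from the other by adding one record.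
   Formalization: The upper bound 2k/ε² is claimed only for 1 ≤ j ≤ k; at j = 0 it is false, since the exact loss there is 2(k+1)/ε² > 2k/ε². The equality is still stated for all 0 ≤ j ≤ k. *)

theory Defs
  imports
    "HOL-Probability.Probability"
    "HOL-Library.Landau_Symbols"
    "Jordan_Normal_Form.Gauss_Jordan_Elimination"
begin

definition datasets :: "real multiset set" where
  "datasets = {D. D \<noteq> {#} \<and> set_mset D \<subseteq> {0..1}}"

definition moment :: "nat \<Rightarrow> real multiset \<Rightarrow> real" where
  "moment j D = (\<Sum>x\<in>#D. x ^ j)"

text \<open>A randomized estimator is represented by the law of its real-valued output on each dataset.\<close>

definition estimator :: "(real multiset \<Rightarrow> real measure) \<Rightarrow> bool" where
  "estimator M \<longleftrightarrow> (\<forall>D\<in>datasets. prob_space (M D) \<and> sets (M D) = sets borel)"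

definition mean_sq_loss ::
  "(real multiset \<Rightarrow> real measure) \<Rightarrow> (real multiset \<Rightarrow> real) \<Rightarrow> real multiset \<Rightarrow> ennreal" where
  "mean_sq_loss M f D = (\<integral>\<^sup>+ y. ennreal ((y - f D)\<^sup>2) \<partial>M D)"

definition adjacent :: "real multiset \<Rightarrow> real multiset \<Rightarrow> bool" where
  "adjacent D D' \<longleftrightarrow> (\<exists>x. D' = add_mset x D \<or> D = add_mset x D')"

definition dp_estimator :: "real \<Rightarrow> (real multiset \<Rightarrow> real measure) \<Rightarrow> bool" where
  "dp_estimator \<epsilon> M \<longleftrightarrow> estimator M \<and>
     (\<forall>D\<in>datasets. \<forall>D'\<in>datasets. adjacent D D' \<longrightarrow>
        (\<forall>S\<in>sets borel. measure (M D) S \<le> exp \<epsilon> * measure (M D') S))"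

text \<open>The Laplace distribution with scale \<open>s\<close>; for \<open>s = 1 / \<epsilon>\<close> its density is
  \<open>\<epsilon> / 2 * exp (- \<epsilon> * \<bar>t\<bar>)\<close>.\<close>

definition laplace_measure :: "real \<Rightarrow> real measure" where
  "laplace_measure s = density lborel (\<lambda>t. ennreal (1 / (2 * s) * exp (- \<bar>t\<bar> / s)))"

definition bezier_matrix :: "nat \<Rightarrow> real Matrix.mat" where
  "bezier_matrix k = Matrix.mat (k + 1) (k + 1)
     (\<lambda>(j, l). if j \<le> l then (-1) ^ (l - j) * real (k choose l) * real (l choose j) else 0)"

definition bezier_output :: "nat \<Rightarrow> real multiset \<Rightarrow> (nat \<Rightarrow> real) \<Rightarrow> real Matrix.vec" where
  "bezier_output k D z = the (mat_inverse (bezier_matrix k)) *\<^sub>v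
     Matrix.vec (k + 1) (\<lambda>j. (\<Sum>x\<in>#D. Bernstein k j x) + z j)"

text \<open>The law of the \<open>j\<close>-th output coordinate, the noise vector being a point of the
  product space.\<close>

definition bezier_estimator :: "nat \<Rightarrow> real \<Rightarrow> nat \<Rightarrow> real multiset \<Rightarrow> real measure" where
  "bezier_estimator k \<epsilon> j D =
     distr (PiM {..k} (\<lambda>_. laplace_measure (1 / \<epsilon>))) borel
       (\<lambda>z. vec_index (bezier_output k D z) j)"

end

theory Submission
  imports Defs "Jordan_Normal_Form.Determinant" "HOL-Real_Asymp.Real_Asymp"
begin

text \<open>The inverse of the Bezier matrix has entries \<open>(l choose j) / (k choose j)\<close>, which expresses
  monomials in the Bernstein basis. Hence the \<open>j\<close>-th output is \<open>\<mu>\<^sub>j\<close> plus the linear combination of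
  independent Laplace variables with these coefficients, and its loss is the variance of the noise.

  For the lower bound consider the datasets consisting of \<open>n\<close> copies of \<open>1\<close>, whose \<open>k\<close>-th moment is \<open>n\<close>,
  and let \<open>a\<^sub>n\<close> be the probability that the output exceeds \<open>n\<close>. Privacy bounds the probability
  of an output above \<open>n + m\<close> from below by \<open>exp (- \<epsilon> m) a\<^sub>n\<^sub>+\<^sub>m\<close> and that of an output at most
  \<open>n - m\<close> by \<open>exp (- \<epsilon> m) (1 - a\<^sub>n\<^sub>-\<^sub>m)\<close>. Averaging over a long range of \<open>n\<close> makes
  \<open>a\<^sub>n\<^sub>+\<^sub>m - a\<^sub>n\<^sub>-\<^sub>m\<close> telescope away, so the worst-case loss is at least the sum of
  \<open>(2 m - 1) exp (- \<epsilon> m)\<close> over \<open>m \<ge> 1\<close>, which is asymptotic to \<open>2 / \<epsilon>\<^sup>2\<close>.\<close>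

section \<open>Inversion of the Bezier matrix\<close>

definition bezier_inverse :: "nat \<Rightarrow> real Matrix.mat" where
  "bezier_inverse k = Matrix.mat (k + 1) (k + 1) (\<lambda>(j, l). real (l choose j) / real (k choose j))"

lemma real_choose_mult:
  assumes "j \<le> l" "l \<le> i"
  shows "real (i choose l) * real (l choose j) = real (i choose j) * real ((i - j) choose (l - j))"
  using choose_mult[OF assms] by (simp flip: of_nat_mult)

text \<open>Trinomial revision pulls the factor \<open>i choose j\<close> out of the sum. What
  remains is the alternating sum of row \<open>i - j\<close> of Pascal's triangle, which vanishes
  unless that row is row 0.\<close>

lemma sum_alternating_choose_choose:
  "(\<Sum>l=j..i. (-1) ^ (l - j) * real (l choose j) * real (i choose l)) = (if i = j then 1 else 0)"
proof (cases "j \<le> i")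
  case True
  have "(\<Sum>l=j..i. (-1) ^ (l - j) * real (l choose j) * real (i choose l)) =
      (\<Sum>l=j..i. real (i choose j) * ((-1) ^ (l - j) * real ((i - j) choose (l - j))))"
  proof (intro sum.cong refl)
    fix l assume "l \<in> {j..i}"
    then have "real (i choose l) * real (l choose j) = real (i choose j) * real ((i - j) choose (l - j))"
      by (intro real_choose_mult) auto
    then show "(-1) ^ (l - j) * real (l choose j) * real (i choose l) =
        real (i choose j) * ((-1) ^ (l - j) * real ((i - j) choose (l - j)))" by (simp add: mult_ac)
  qed
  also have "\<dots> = real (i choose j) * (\<Sum>l\<le>i - j. (-1) ^ l * real ((i - j) choose l))"
    unfolding sum_distrib_left
    by (rule sum.reindex_bij_witness[of _ "\<lambda>l. l + j" "\<lambda>l. l - j"]) (use True in auto)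
  also have "\<dots> = (if i = j then 1 else 0)"
    using choose_alternating_sum[of "i - j", where 'a = real] True by auto
  finally show ?thesis .
qed auto

lemma bezier_matrix_mult_inverse: "bezier_matrix k * bezier_inverse k = 1\<^sub>m (k + 1)"
proof (rule eq_matI)
  fix j i assume "j < dim_row (1\<^sub>m (k + 1) :: real Matrix.mat)" "i < dim_col (1\<^sub>m (k + 1) :: real Matrix.mat)"
  then have ji: "j \<le> k" "i \<le> k" by auto
  have "(bezier_matrix k * bezier_inverse k) $$ (j, i) =
      (\<Sum>l=0..<k+1. (if j \<le> l then (-1) ^ (l - j) * real (k choose l) * real (l choose j) else 0) *
         (real (i choose l) / real (k choose l)))"
    using ji by (simp add: bezier_matrix_def bezier_inverse_def scalar_prod_def del: sum.op_ivl_Suc)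
  \<comment> \<open>The factors \<open>k choose l\<close> cancel, and \<open>i choose l\<close> is
    zero for \<open>l > i\<close>, so only \<open>j \<le> l \<le> i\<close> survives.\<close>
  also have "\<dots> = (\<Sum>l=j..i. (-1) ^ (l - j) * real (l choose j) * real (i choose l))"
    using ji by (intro sum.mono_neutral_cong_right) auto
  also have "\<dots> = (1\<^sub>m (k + 1) :: real Matrix.mat) $$ (j, i)"
    using ji by (subst sum_alternating_choose_choose) auto
  finally show "(bezier_matrix k * bezier_inverse k) $$ (j, i) = (1\<^sub>m (k + 1) :: real Matrix.mat) $$ (j, i)" .
qed (auto simp: bezier_matrix_def bezier_inverse_def)

text \<open>For square matrices a right inverse is two-sided, so the matrix is a unit and
  \<open>mat_inverse\<close> cannot return \<open>None\<close>. Its result \<open>B\<close> is then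
  identified by uniqueness of inverses: B = B (A C) = (B A) C = C.\<close>

lemma mat_inverse_bezier_matrix: "mat_inverse (bezier_matrix k) = Some (bezier_inverse k)"
proof -
  have A: "bezier_matrix k \<in> carrier_mat (k + 1) (k + 1)" and C: "bezier_inverse k \<in> carrier_mat (k + 1) (k + 1)"
    by (auto simp: bezier_matrix_def bezier_inverse_def)
  note AC = bezier_matrix_mult_inverse[of k]
  note CA = mat_mult_left_right_inverse[OF A C AC]
  have "bezier_matrix k \<in> Units (ring_mat TYPE(real) (k + 1) ())"
    using A C AC CA unfolding Units_def by (auto simp: ring_mat_simps)
  then obtain B where B: "mat_inverse (bezier_matrix k) = Some B"
    using mat_inverse(1)[OF A, where b = "()"] by auto
  note B' = mat_inverse(2)[OF A B]
  have "B = B * (bezier_matrix k * bezier_inverse k)"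
    unfolding AC using B' right_mult_one_mat by metis
  also have "\<dots> = B * bezier_matrix k * bezier_inverse k"
    using assoc_mult_mat[OF conjunct2[OF conjunct2[OF B']] A C] by simp
  also have "\<dots> = bezier_inverse k" using B' C by simp
  finally show ?thesis using B by simp
qed

section \<open>The mechanism's output as exact moment plus noise\<close>

lemma sum_Bernstein_choose:
  assumes "j \<le> k"
  shows "(\<Sum>l\<le>k. real (l choose j) / real (k choose j) * Bernstein k l t) = t ^ j"
proof -
  have "(\<Sum>l\<le>k. real (l choose j) / real (k choose j) * Bernstein k l t) =
      (\<Sum>l=j..k. t ^ j * (real ((k - j) choose (l - j)) * t ^ (l - j) * (1 - t) ^ (k - l)))"
  proof (intro sum.mono_neutral_cong_right ballI)
    fix l assume l: "l \<in> {j..k}"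
    then have "real (k choose l) * real (l choose j) = real (k choose j) * real ((k - j) choose (l - j))"
      by (intro real_choose_mult) auto
    moreover have "real (k choose j) \<noteq> 0" using assms by simp
    ultimately have "real (l choose j) / real (k choose j) * real (k choose l) = real ((k - j) choose (l - j))"
      by (simp add: field_simps)
    moreover have "t ^ l = t ^ j * t ^ (l - j)" using l by (simp add: power_add[symmetric])
    ultimately show "real (l choose j) / real (k choose j) * Bernstein k l t =
        t ^ j * (real ((k - j) choose (l - j)) * t ^ (l - j) * (1 - t) ^ (k - l))"
      by (simp add: Bernstein_def mult.assoc[symmetric])
  qed auto
  \<comment> \<open>After shifting the index by \<open>j\<close>, the sum is the binomial expansion
    of (t + (1 - t))^(k - j) = 1.\<close>
  also have "\<dots> = t ^ j * (\<Sum>m\<le>k - j. real ((k - j) choose m) * t ^ m * (1 - t) ^ (k - j - m))"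
    unfolding sum_distrib_left
    by (rule sum.reindex_bij_witness[of _ "\<lambda>l. l + j" "\<lambda>l. l - j"]) (use assms in auto)
  also have "\<dots> = t ^ j"
    using binomial_ring[of t "1 - t" "k - j"] by simp
  finally show ?thesis .
qed

lemma bezier_output_index:
  assumes "j \<le> k"
  shows "vec_index (bezier_output k D z) j =
    moment j D + (\<Sum>l\<le>k. real (l choose j) / real (k choose j) * z l)"
proof -
  have "vec_index (bezier_output k D z) j =
      (\<Sum>l\<le>k. real (l choose j) / real (k choose j) * ((\<Sum>x\<in>#D. Bernstein k l x) + z l))"
    using assms
    by (simp add: bezier_output_def mat_inverse_bezier_matrix bezier_inverse_def scalar_prod_def
        atLeast0LessThan lessThan_Suc_atMost del: sum.op_ivl_Suc sum.lessThan_Suc)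
  also have "\<dots> = (\<Sum>l\<le>k. \<Sum>x\<in>#D. real (l choose j) / real (k choose j) * Bernstein k l x) +
      (\<Sum>l\<le>k. real (l choose j) / real (k choose j) * z l)"
    by (simp only: distrib_left sum.distrib sum_mset_distrib_left)
  also have "(\<Sum>l\<le>k. \<Sum>x\<in>#D. real (l choose j) / real (k choose j) * Bernstein k l x) =
      (\<Sum>x\<in>#D. \<Sum>l\<le>k. real (l choose j) / real (k choose j) * Bernstein k l x)"
    by (induction D) (simp_all add: sum.distrib)
  also have "\<dots> = moment j D"
    by (simp only: sum_Bernstein_choose[OF assms] moment_def)
  finally show ?thesis .
qed

section \<open>Moments of Laplace noise and the exact loss\<close>

lemma has_bochner_integral_laplace_power:
  assumes "s > 0"
  shows "has_bochner_integral (laplace_measure s) (\<lambda>x. x ^ p) (if even p then s ^ p * fact p else 0)"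
proof -
  let ?f = "\<lambda>x. 1 / (2 * s) * exp (- \<bar>x\<bar> / s) * x ^ p :: real"
  have "has_bochner_integral lborel (\<lambda>x. x ^ p * exp (- x) * indicator {0..} x) (fact p :: real)"
    by (rule has_bochner_integral_I0i_power_exp_m')
  \<comment> \<open>The substitution of \<open>x / s\<close> for \<open>x\<close> turns the Gamma
    integral \<open>fact p\<close> into the half-line moment at scale \<open>s\<close>.\<close>
  then have "has_bochner_integral lborel
      (\<lambda>x. (0 + 1 / s * x) ^ p * exp (- (0 + 1 / s * x)) * indicator {0..} (0 + 1 / s * x)) (fact p /\<^sub>R \<bar>1 / s\<bar>)"
    using assms by (subst (asm) lborel_has_bochner_integral_real_affine_iff[where c = "1 / s" and t = 0]) auto
  then have "has_bochner_integral lborel (\<lambda>x. s ^ p / (2 * s) *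
      ((0 + 1 / s * x) ^ p * exp (- (0 + 1 / s * x)) * indicator {0..} (0 + 1 / s * x)))
      (s ^ p / (2 * s) * (fact p /\<^sub>R \<bar>1 / s\<bar>))"
    by (intro has_bochner_integral_mult_right)
  moreover have "s ^ p / (2 * s) *
      ((0 + 1 / s * x) ^ p * exp (- (0 + 1 / s * x)) * indicator {0..} (0 + 1 / s * x)) =
      indicator {0..} x *\<^sub>R ?f x" for x
    using assms by (auto simp: indicator_def zero_le_divide_iff power_divide)
  moreover have "s ^ p / (2 * s) * (fact p /\<^sub>R \<bar>1 / s\<bar>) = s ^ p * fact p / 2"
    using assms by simp
  ultimately have half: "has_bochner_integral lborel (\<lambda>x. indicator {0..} x *\<^sub>R ?f x) (s ^ p * fact p / 2)"
    by (simp only:)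
  have "has_bochner_integral lborel ?f (if even p then s ^ p * fact p else 0)"
    \<comment> \<open>The two half-line contributions add up for even \<open>p\<close> and cancel
      for odd \<open>p\<close>.\<close>
    using has_bochner_integral_even_function[OF half] has_bochner_integral_odd_function[OF half] by auto
  then show ?thesis unfolding laplace_measure_def
    using assms by (intro has_bochner_integral_density) auto
qed

lemma prob_space_laplace_measure:
  assumes "s > 0"
  shows "prob_space (laplace_measure s)"
proof
  have "has_bochner_integral (laplace_measure s) (\<lambda>x. 1::real) 1"
    using has_bochner_integral_laplace_power[OF assms, of 0] by simp
  then have "(\<integral>\<^sup>+x. ennreal 1 \<partial>laplace_measure s) = ennreal 1"
    by (subst nn_integral_eq_integral) (simp_all add: has_bochner_integral_iff)
  then show "emeasure (laplace_measure s) (space (laplace_measure s)) = 1" by simp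
qed

text \<open>The square expands into a double sum of products of coordinates. On the product space
  the off-diagonal products integrate to the square of the mean, which is zero, and each diagonal
  one gives \<open>v\<close>.\<close>

lemma has_bochner_integral_PiM_square_sum:
  fixes c :: "'i \<Rightarrow> real" and N :: "real measure"
  assumes "prob_space N" "finite I"
    and mean: "has_bochner_integral N (\<lambda>x. x) 0"
    and var: "has_bochner_integral N (\<lambda>x. x\<^sup>2) v"
  shows "has_bochner_integral (PiM I (\<lambda>_. N)) (\<lambda>z. (\<Sum>i\<in>I. c i * z i)\<^sup>2) (v * (\<Sum>i\<in>I. (c i)\<^sup>2))"
proof -
  interpret N: prob_space N by fact
  interpret product_sigma_finite "\<lambda>_::'i. N" by standard
  have cov: "has_bochner_integral (PiM I (\<lambda>_. N)) (\<lambda>z. z i * z j) (if i = j then v else 0)"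
    if ij: "i \<in> I" "j \<in> I" for i j
  proof -
    \<comment> \<open>\<open>e l\<close> counts how many of \<open>i\<close>, \<open>j\<close> equal
      \<open>l\<close>. This writes \<open>z i * z j\<close> as a product over all of
      \<open>I\<close>, as the product integral theorem requires, uniformly for \<open>i = j\<close>
      and \<open>i \<noteq> j\<close>. The exponents 2, 1, 0 call for variance, mean and total
      mass.\<close>
    define e :: "'i \<Rightarrow> nat" where "e l = of_bool (l = i) + of_bool (l = j)" for l
    have int: "has_bochner_integral N (\<lambda>x. x ^ e l)
        (if l = i \<and> l = j then v else if l = i \<or> l = j then 0 else 1)" for l
    proof -
      consider "l = i" "l = j" "e l = 2" | "(l = i) \<noteq> (l = j)" "e l = 1" | "l \<noteq> i" "l \<noteq> j" "e l = 0"
        unfolding e_def by fastforce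
      then show ?thesis
      proof cases
        case 3
        then show ?thesis by (simp add: has_bochner_integral_iff N.prob_space)
      qed (use mean var in auto)
    qed
    have "has_bochner_integral (PiM I (\<lambda>_. N)) (\<lambda>z. \<Prod>l\<in>I. z l ^ e l)
        (\<Prod>l\<in>I. if l = i \<and> l = j then v else if l = i \<or> l = j then 0 else 1)"
      using int product_integrable_prod[OF assms(2), of "\<lambda>l x. x ^ e l"]
        product_integral_prod[OF assms(2), of "\<lambda>l x. x ^ e l"]
      by (simp add: has_bochner_integral_iff)
    moreover have "(\<Prod>l\<in>I. z l ^ e l) = z i * z j" for z :: "'i \<Rightarrow> real"
    proof -
      have "(\<Prod>l\<in>I. z l ^ e l) = (\<Prod>l\<in>I. (if l = i then z l else 1) * (if l = j then z l else 1))"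
        by (intro prod.cong refl) (auto simp: e_def power2_eq_square)
      then show ?thesis using ij assms(2) by (simp add: prod.distrib prod.delta)
    qed
    moreover have "(\<Prod>l\<in>I. if l = i \<and> l = j then v else if l = i \<or> l = j then 0 else 1) =
        (if i = j then v else 0)"
    proof (cases "i = j")
      case True
      then have "(\<Prod>l\<in>I. if l = i \<and> l = j then v else if l = i \<or> l = j then 0 else 1) =
          (\<Prod>l\<in>I. if l = j then v else 1)"
        by (intro prod.cong) auto
      then show ?thesis using True ij assms(2) by simp
    next
      case False
      then show ?thesis using ij assms(2) by (auto intro!: prod_zero)
    qed
    ultimately show ?thesis by simp
  qed
  have "has_bochner_integral (PiM I (\<lambda>_. N)) (\<lambda>z. \<Sum>i\<in>I. \<Sum>j\<in>I. c i * c j * (z i * z j))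
      (\<Sum>i\<in>I. \<Sum>j\<in>I. c i * c j * (if i = j then v else 0))"
    by (intro has_bochner_integral_sum has_bochner_integral_mult_right cov)
  moreover have "(\<Sum>i\<in>I. \<Sum>j\<in>I. c i * c j * (if i = j then v else 0)) = v * (\<Sum>i\<in>I. (c i)\<^sup>2)"
  proof -
    have "(\<Sum>j\<in>I. c i * c j * (if i = j then v else 0)) = v * (c i)\<^sup>2" if "i \<in> I" for i
    proof -
      have "(\<Sum>j\<in>I. c i * c j * (if i = j then v else 0)) = (\<Sum>j\<in>I. if i = j then v * (c i)\<^sup>2 else 0)"
        by (intro sum.cong refl) (simp add: power2_eq_square)
      then show ?thesis using that assms(2) by simp
    qed
    then show ?thesis by (simp add: sum_distrib_left)
  qed
  moreover have "(\<Sum>i\<in>I. \<Sum>j\<in>I. c i * c j * (z i * z j)) = (\<Sum>i\<in>I. c i * z i)\<^sup>2" for z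
    unfolding power2_eq_square sum_product by (intro sum.cong refl) (simp add: mult_ac)
  ultimately show ?thesis by simp
qed

text \<open>The true moment cancels in the error, so the loss is the second moment of the weighted
  noise and does not depend on \<open>D\<close>. Each coordinate has variance
  \<open>2 / \<epsilon>\<^sup>2\<close>.\<close>

lemma mean_sq_loss_bezier_estimator:
  assumes "\<epsilon> > 0" "j \<le> k"
  shows "mean_sq_loss (bezier_estimator k \<epsilon> j) (moment j) D =
    ennreal (2 / (\<epsilon>\<^sup>2 * (real (k choose j))\<^sup>2) * (\<Sum>l=j..k. (real (l choose j))\<^sup>2))"
proof -
  let ?N = "laplace_measure (1 / \<epsilon>)"
  let ?P = "PiM {..k} (\<lambda>_. ?N)"
  let ?c = "\<lambda>l. real (l choose j) / real (k choose j)"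
  have [measurable_cong]: "sets ?N = sets borel" by (simp add: laplace_measure_def)
  have int: "has_bochner_integral ?P (\<lambda>z. (\<Sum>l\<le>k. ?c l * z l)\<^sup>2) (2 / \<epsilon>\<^sup>2 * (\<Sum>l\<le>k. (?c l)\<^sup>2))"
  proof (rule has_bochner_integral_PiM_square_sum)
    show "prob_space ?N" using assms(1) by (intro prob_space_laplace_measure) simp
    show "has_bochner_integral ?N (\<lambda>x. x) 0"
      using has_bochner_integral_laplace_power[of "1 / \<epsilon>" 1] assms(1) by simp
    show "has_bochner_integral ?N (\<lambda>x. x\<^sup>2) (2 / \<epsilon>\<^sup>2)"
      using has_bochner_integral_laplace_power[of "1 / \<epsilon>" 2] assms(1) by (simp add: power_divide)
  qed simp
  have "mean_sq_loss (bezier_estimator k \<epsilon> j) (moment j) D = (\<integral>\<^sup>+z. ennreal ((\<Sum>l\<le>k. ?c l * z l)\<^sup>2) \<partial>?P)"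
    unfolding mean_sq_loss_def bezier_estimator_def bezier_output_index[OF assms(2)]
    by (subst nn_integral_distr) auto
  also have "\<dots> = ennreal (2 / \<epsilon>\<^sup>2 * (\<Sum>l\<le>k. (?c l)\<^sup>2))"
    using int by (subst nn_integral_eq_integral) (auto simp: has_bochner_integral_iff)
  also have "(\<Sum>l\<le>k. (?c l)\<^sup>2) = (\<Sum>l=j..k. (?c l)\<^sup>2)"
    by (rule sum.mono_neutral_right) auto
  also have "2 / \<epsilon>\<^sup>2 * \<dots> = 2 / (\<epsilon>\<^sup>2 * (real (k choose j))\<^sup>2) * (\<Sum>l=j..k. (real (l choose j))\<^sup>2)"
    by (simp add: power_divide sum_divide_distrib[symmetric])
  finally show ?thesis .
qed

text \<open>None of the \<open>k - j + 1\<close> squares exceeds the last one, and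
  \<open>j \<ge> 1\<close> leaves at most \<open>k\<close> of them. For \<open>j = 0\<close> there
  are \<open>k + 1\<close> squares, all equal to 1, so the bound fails for every nonzero
  \<epsilon>.\<close>

lemma bezier_loss_le:
  fixes \<epsilon> :: real
  assumes "1 \<le> j" "j \<le> k"
  shows "2 / (\<epsilon>\<^sup>2 * (real (k choose j))\<^sup>2) * (\<Sum>l=j..k. (real (l choose j))\<^sup>2) \<le> 2 * real k / \<epsilon>\<^sup>2"
proof -
  have pos: "real (k choose j) > 0" using assms by simp
  have "(\<Sum>l=j..k. (real (l choose j))\<^sup>2) \<le> (\<Sum>l=j..k. (real (k choose j))\<^sup>2)"
    by (intro sum_mono power_mono) (auto intro: binomial_right_mono)
  also have "\<dots> \<le> real k * (real (k choose j))\<^sup>2"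
    using assms by (auto intro!: mult_right_mono)
  finally have "2 / (\<epsilon>\<^sup>2 * (real (k choose j))\<^sup>2) * (\<Sum>l=j..k. (real (l choose j))\<^sup>2)
      \<le> 2 / (\<epsilon>\<^sup>2 * (real (k choose j))\<^sup>2) * (real k * (real (k choose j))\<^sup>2)"
    by (intro mult_left_mono) auto
  then show ?thesis using pos by simp
qed

section \<open>Privacy lower bound along datasets of equal records\<close>

lemma measure_replicate_mset_bound:
  assumes "dp_estimator \<epsilon> M" "S \<in> sets borel" "x \<in> {0..1}" "n \<ge> 1"
  shows "measure (M (replicate_mset n x)) S \<le> exp (\<epsilon> * real m) * measure (M (replicate_mset (n + m) x)) S"
    and "measure (M (replicate_mset (n + m) x)) S \<le> exp (\<epsilon> * real m) * measure (M (replicate_mset n x)) S"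
proof -
  have D: "replicate_mset i x \<in> datasets" if "i \<ge> 1" for i
    using that assms(3) by (auto simp: datasets_def)
  have step: "measure (M D) S \<le> exp \<epsilon> * measure (M D') S"
    if "D \<in> datasets" "D' \<in> datasets" "adjacent D D'" for D D'
    using assms(1,2) that unfolding dp_estimator_def by blast
  \<comment> \<open>One record is added or removed at a time. Privacy is imposed only between
    members of \<open>datasets\<close>, so \<open>i \<ge> 1\<close> keeps the chain away from the
    empty multiset.\<close>
  have up: "measure (M (replicate_mset i x)) S \<le> exp \<epsilon> * measure (M (replicate_mset (Suc i) x)) S"
    and down: "measure (M (replicate_mset (Suc i) x)) S \<le> exp \<epsilon> * measure (M (replicate_mset i x)) S"
    if "i \<ge> 1" for i
    using that D[of i] D[of "Suc i"] by (auto intro!: step simp: adjacent_def simp del: replicate_mset_Suc)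
       (auto simp: replicate_mset_Suc)
  show "measure (M (replicate_mset n x)) S \<le> exp (\<epsilon> * real m) * measure (M (replicate_mset (n + m) x)) S"
  proof (induction m)
    case (Suc m)
    note Suc
    also have "exp (\<epsilon> * real m) * measure (M (replicate_mset (n + m) x)) S
        \<le> exp (\<epsilon> * real m) * (exp \<epsilon> * measure (M (replicate_mset (Suc (n + m)) x)) S)"
      using up[of "n + m"] assms(4) by (intro mult_left_mono) auto
    finally show ?case by (simp add: exp_add algebra_simps)
  qed simp
  show "measure (M (replicate_mset (n + m) x)) S \<le> exp (\<epsilon> * real m) * measure (M (replicate_mset n x)) S"
  proof (induction m)
    case (Suc m)
    have "measure (M (replicate_mset (Suc (n + m)) x)) S \<le> exp \<epsilon> * measure (M (replicate_mset (n + m) x)) S"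
      using down[of "n + m"] assms(4) by auto
    also have "\<dots> \<le> exp \<epsilon> * (exp (\<epsilon> * real m) * measure (M (replicate_mset n x)) S)"
      using Suc by (intro mult_left_mono) auto
    finally show ?case by (simp add: exp_add algebra_simps)
  qed simp
qed

lemma sum_odd_numbers: "(\<Sum>m=1..n. 2 * real m - 1) = (real n)\<^sup>2"
  by (induction n) (auto simp: power2_eq_square algebra_simps)

text \<open>A discrete layer-cake bound: for each \<open>m\<close> at most one of the two tails
  contains \<open>y\<close>, and then \<open>m\<close> is at most the floor \<open>N\<close> of the
  distance from \<open>y\<close> to \<open>c\<close>. The weights are odd numbers, so they sum to at
  most \<open>N\<^sup>2\<close>.\<close>

lemma square_ge_sum_tail_indicators:
  fixes y :: real
  shows "(\<Sum>m=1..K. (2 * real m - 1) * (indicator {c + real m<..} y + indicator {..c - real m} y))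
    \<le> (y - c)\<^sup>2"
proof -
  define N where "N = nat \<lfloor>\<bar>y - c\<bar>\<rfloor>"
  have N: "real N \<le> \<bar>y - c\<bar>" "m \<le> N" if "real m \<le> \<bar>y - c\<bar>" for m :: nat
    using that unfolding N_def by (auto simp: le_nat_floor)
  have "(\<Sum>m=1..K. (2 * real m - 1) * (indicator {c + real m<..} y + indicator {..c - real m} y))
      \<le> (\<Sum>m=1..K. if m \<le> N then 2 * real m - 1 else 0)"
    by (intro sum_mono) (auto simp: indicator_def intro: N(2))
  also have "\<dots> = (\<Sum>m\<in>{1..K} \<inter> {..N}. 2 * real m - 1)"
    by (subst sum.inter_restrict) auto
  also have "\<dots> \<le> (\<Sum>m=1..N. 2 * real m - 1)"
    by (intro sum_mono2) auto
  also have "\<dots> = (real N)\<^sup>2" by (rule sum_odd_numbers)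
  also have "\<dots> \<le> (y - c)\<^sup>2"
    using N(1)[of 0] by (simp add: abs_le_square_iff[symmetric])
  finally show ?thesis .
qed

text \<open>The difference is that of two sums over windows shifted by \<open>2 * m\<close>. Only
  the first \<open>2 * m\<close> terms of the lower window can lie outside the upper one, and each
  is at most 1. The condition \<open>m \<le> K\<close> keeps natural subtraction exact.\<close>

lemma sum_shift_diff_ge:
  fixes a :: "nat \<Rightarrow> real"
  assumes "\<And>n. 0 \<le> a n" "\<And>n. a n \<le> 1" "m \<le> K"
  shows "- 2 * real m \<le> (\<Sum>n=K+1..K+N. a (n + m) - a (n - m))"
proof -
  have "(\<Sum>n=K+1..K+N. a (n + m) - a (n - m)) =
      (\<Sum>n=K+1+m..K+N+m. a n) - (\<Sum>n=K+1-m..K+N-m. a n)"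
  proof -
    have "(\<Sum>n=K+1..K+N. a (n + m)) = (\<Sum>n=K+1+m..K+N+m. a n)"
      by (rule sum.reindex_bij_witness[of _ "\<lambda>n. n - m" "\<lambda>n. n + m"]) auto
    moreover have "(\<Sum>n=K+1..K+N. a (n - m)) = (\<Sum>n=K+1-m..K+N-m. a n)"
      by (rule sum.reindex_bij_witness[of _ "\<lambda>n. n + m" "\<lambda>n. n - m"]) (use assms(3) in auto)
    ultimately show ?thesis by (simp add: sum_subtractf)
  qed
  \<comment> \<open>This cover of the lower window is valid even when the two windows do not
    meet.\<close>
  moreover have "(\<Sum>n=K+1-m..K+N-m. a n) \<le> (\<Sum>n\<in>{K+1-m..K+m} \<union> {K+1+m..K+N+m}. a n)"
    by (rule sum_mono2) (use assms in auto)
  moreover have "(\<Sum>n\<in>{K+1-m..K+m} \<union> {K+1+m..K+N+m}. a n) =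
      (\<Sum>n=K+1-m..K+m. a n) + (\<Sum>n=K+1+m..K+N+m. a n)"
    by (rule sum.union_disjoint) auto
  moreover have "(\<Sum>n=K+1-m..K+m. a n) \<le> 2 * real m"
    using sum_bounded_above[of "{K+1-m..K+m}" a 1] assms by auto
  ultimately show ?thesis by simp
qed

text \<open>The threshold \<open>n + m\<close> is the true moment for \<open>n + m\<close> copies of
  1, and \<open>n - m\<close> that for \<open>n - m\<close> copies. Moving each tail event to that
  dataset costs a factor \<open>exp (\<epsilon> * real m)\<close>.\<close>

lemma replicate_one_tail_bounds:
  fixes M \<epsilon> n m
  defines "P \<equiv> \<lambda>n. measure (M (replicate_mset n (1::real)))"
  assumes "dp_estimator \<epsilon> M" "m < n"
  shows "P n {real n + real m<..} + P n {..real n - real m} \<ge>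
    exp (- \<epsilon> * real m) * (1 + (P (n + m) {real (n + m)<..} - P (n - m) {real (n - m)<..}))"
proof -
  have "replicate_mset (n - m) (1::real) \<in> datasets"
    using assms(3) by (auto simp: datasets_def)
  then interpret prob_space "M (replicate_mset (n - m) (1::real))"
    using assms(2) unfolding dp_estimator_def estimator_def by blast
  have sets: "sets (M (replicate_mset (n - m) (1::real))) = sets borel"
    using assms(2) \<open>replicate_mset (n - m) (1::real) \<in> datasets\<close>
    unfolding dp_estimator_def estimator_def by blast
  then have sp: "space (M (replicate_mset (n - m) (1::real))) = UNIV"
    by (simp add: sets_eq_imp_space_eq[OF sets])
  \<comment> \<open>Open upper and closed lower rays are complementary, so the lower tail too is
    governed by the probability of exceeding the true moment.\<close>
  have "{..real (n - m)} = UNIV - {real (n - m)<..}" by auto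
  then have c: "P (n - m) {..real (n - m)} = 1 - P (n - m) {real (n - m)<..}"
    unfolding P_def using prob_compl[of "{real (n - m)<..}"] sp sets by simp
  have "P (n + m) {real (n + m)<..} \<le> exp (\<epsilon> * real m) * P n {real (n + m)<..}"
    unfolding P_def using assms(3) by (intro measure_replicate_mset_bound[OF assms(2)]) auto
  moreover have "P (n - m) {..real (n - m)} \<le> exp (\<epsilon> * real m) * P n {..real (n - m)}"
    using measure_replicate_mset_bound(1)[OF assms(2), of "{..real (n - m)}" 1 "n - m" m] assms(3)
    unfolding P_def by auto
  ultimately have "1 + (P (n + m) {real (n + m)<..} - P (n - m) {real (n - m)<..})
     \<le> exp (\<epsilon> * real m) * (P n {real n + real m<..} + P n {..real n - real m})"
    using c assms(3) by (simp add: algebra_simps of_nat_diff)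
  then show ?thesis by (simp add: exp_minus field_simps)
qed

text \<open>Integrating the layer-cake bound around \<open>n\<close>, the moment of \<open>n\<close>
  ones for every degree \<open>k\<close>, reduces the loss to tail probabilities.
  \<open>K < n\<close> makes every dataset involved nonempty.\<close>

lemma replicate_one_loss_ge:
  fixes M \<epsilon> n
  defines "a \<equiv> \<lambda>n. measure (M (replicate_mset n (1::real))) {real n<..}"
  assumes "dp_estimator \<epsilon> M" "K < n"
  shows "ennreal (\<Sum>m=1..K. (2 * real m - 1) * (exp (- \<epsilon> * real m) * (1 + (a (n + m) - a (n - m)))))
    \<le> mean_sq_loss M (moment k) (replicate_mset n 1)"
proof -
  define Q where "Q = M (replicate_mset n (1::real))"
  have "replicate_mset n (1::real) \<in> datasets"
    using assms(3) by (auto simp: datasets_def)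
  then have sets [measurable_cong]: "sets Q = sets borel" and "prob_space Q"
    using assms(2) unfolding dp_estimator_def estimator_def Q_def by blast+
  then interpret prob_space Q by simp
  have int: "integrable Q (indicator S :: real \<Rightarrow> real)" "(\<integral>y. indicator S y \<partial>Q) = measure Q S"
    if "S \<in> sets borel" for S
    using that by (auto simp: sets integrable_indicator_iff emeasure_eq_measure)
  let ?g = "\<lambda>y. \<Sum>m=1..K. (2 * real m - 1) * (indicator {real n + real m<..} y + indicator {..real n - real m} y)"
  have "ennreal (\<Sum>m=1..K. (2 * real m - 1) * (exp (- \<epsilon> * real m) * (1 + (a (n + m) - a (n - m)))))
      \<le> ennreal (\<Sum>m=1..K. (2 * real m - 1) *
           (measure Q {real n + real m<..} + measure Q {..real n - real m}))"
    using replicate_one_tail_bounds[OF assms(2)] assms(3) unfolding a_def Q_def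
    by (intro ennreal_leI sum_mono mult_left_mono) auto
  also have "(\<Sum>m=1..K. (2 * real m - 1) *
           (measure Q {real n + real m<..} + measure Q {..real n - real m})) = (\<integral>y. ?g y \<partial>Q)"
    using int by (subst Bochner_Integration.integral_sum) (auto simp del: integral_indicator)
  also have "ennreal \<dots> = (\<integral>\<^sup>+y. ennreal (?g y) \<partial>Q)"
    using int by (intro nn_integral_eq_integral[symmetric] Bochner_Integration.integrable_sum) (auto intro!: sum_nonneg)
  also have "\<dots> \<le> (\<integral>\<^sup>+y. ennreal ((y - real n)\<^sup>2) \<partial>Q)"
    by (intro nn_integral_mono ennreal_leI square_ge_sum_tail_indicators)
  finally show ?thesis by (simp add: mean_sq_loss_def Q_def moment_def)
qed

text \<open>Summing the loss bounds over a window of \<open>N\<close> values of \<open>n\<close>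
  costs a telescoping error of at most \<open>2 * m\<close> for each \<open>m\<close>. This error is
  negligible against \<open>N\<close>.\<close>

lemma sup_loss_ge_partial_sum:
  assumes "dp_estimator \<epsilon> M"
    and "\<And>n. n \<ge> 1 \<Longrightarrow> mean_sq_loss M (moment k) (replicate_mset n 1) \<le> ennreal v" "0 \<le> v"
  shows "(\<Sum>m=1..K. (2 * real m - 1) * exp (- \<epsilon> * real m)) \<le> v"
proof -
  define c where "c m = (2 * real m - 1) * exp (- \<epsilon> * real m)" for m
  \<comment> \<open>The law of \<open>M\<close> on the empty multiset is unconstrained. The default
    0 keeps \<open>a\<close> within [0,1] everywhere, and index 0 never enters the window sums since
    \<open>n > K \<ge> m\<close>.\<close>
  define a where "a = (\<lambda>n. if n = 0 then 0 else measure (M (replicate_mset n (1::real))) {real n<..})"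
  have D: "prob_space (M (replicate_mset n (1::real)))" if "n \<noteq> 0" for n
    using assms(1) that unfolding dp_estimator_def estimator_def datasets_def by force
  have a: "0 \<le> a n" "a n \<le> 1" for n
    by (auto simp: a_def prob_space.prob_le_1[OF D])
  have c: "c m \<ge> 0" if "m \<in> {1..K}" for m using that by (auto simp: c_def)
  have main: "(\<Sum>m=1..K. c m * (real N - 2 * real m)) \<le> real N * v" for N
  proof -
    have "(\<Sum>m=1..K. c m * (real N - 2 * real m)) \<le>
        (\<Sum>m=1..K. c m * (real N + (\<Sum>n=K+1..K+N. a (n + m) - a (n - m))))"
    proof (intro sum_mono mult_left_mono)
      fix m assume m: "m \<in> {1..K}"
      then show "real N - 2 * real m \<le> real N + (\<Sum>n=K+1..K+N. a (n + m) - a (n - m))"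
        using sum_shift_diff_ge[of a m K N, OF a] by auto
    qed (rule c)
    also have "\<dots> = (\<Sum>m=1..K. c m * (\<Sum>n=K+1..K+N. 1 + (a (n + m) - a (n - m))))"
      by (simp add: sum.distrib)
    also have "\<dots> = (\<Sum>n=K+1..K+N. \<Sum>m=1..K. c m * (1 + (a (n + m) - a (n - m))))"
      unfolding sum_distrib_left by (rule sum.swap)
    also have "\<dots> \<le> (\<Sum>n=K+1..K+N. v)"
    proof (rule sum_mono)
      fix n assume n: "n \<in> {K+1..K+N}"
      have "ennreal (\<Sum>m=1..K. c m * (1 + (a (n + m) - a (n - m)))) \<le> ennreal v"
      proof -
        have "(\<Sum>m=1..K. c m * (1 + (a (n + m) - a (n - m)))) =
            (\<Sum>m=1..K. (2 * real m - 1) * (exp (- \<epsilon> * real m) *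
              (1 + (measure (M (replicate_mset (n + m) (1::real))) {real (n + m)<..}
                - measure (M (replicate_mset (n - m) (1::real))) {real (n - m)<..}))))"
          using n by (intro sum.cong refl) (simp add: c_def a_def mult.assoc)
        then show ?thesis
          using order_trans[OF replicate_one_loss_ge[OF assms(1), of K n k] assms(2)[of n]] n by simp
      qed
      then show "(\<Sum>m=1..K. c m * (1 + (a (n + m) - a (n - m)))) \<le> v"
        using assms(3) by (simp add: ennreal_le_iff)
    qed
    finally show ?thesis by simp
  qed
  \<comment> \<open>Division by \<open>N\<close> and the limit in \<open>N\<close>, with
    \<open>K\<close> fixed, remove the error.\<close>
  have "(\<lambda>N. (\<Sum>m=1..K. c m * (1 - 2 * real m / real N))) \<longlonglongrightarrow> (\<Sum>m=1..K. c m * (1 - 0))"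
    by (intro tendsto_intros)
  moreover have "\<forall>\<^sub>F N in sequentially. (\<Sum>m=1..K. c m * (1 - 2 * real m / real N)) \<le> v"
    using eventually_gt_at_top[of 0]
  proof eventually_elim
    case (elim N)
    have "(\<Sum>m=1..K. c m * (1 - 2 * real m / real N)) = (\<Sum>m=1..K. c m * (real N - 2 * real m)) / real N"
      using elim by (auto simp: sum_divide_distrib field_simps intro!: sum.cong)
    then show ?case using main[of N] elim by (simp only: divide_le_eq mult.commute) simp
  qed
  ultimately have "(\<Sum>m=1..K. c m * (1 - 0)) \<le> v"
    by (rule tendsto_upperbound) simp
  then show ?thesis by (simp add: c_def)
qed

section \<open>Closed form of the lower bound and its asymptotics\<close>

lemma sums_odd_times_power:
  fixes x :: real
  assumes "\<bar>x\<bar> < 1"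
  shows "(\<lambda>m. (2 * real (Suc m) - 1) * x ^ Suc m) sums (x * (1 + x) / (1 - x)\<^sup>2)"
proof -
  \<comment> \<open>The weight \<open>2 * m - 1\<close> splits the series into twice a
    differentiated geometric series and a plain one.\<close>
  have "(\<lambda>m. 2 * x * (real (Suc m) * x ^ m) - x * x ^ m) sums (2 * x * (1 / (1 - x)\<^sup>2) - x * (1 / (1 - x)))"
    using assms by (intro sums_diff sums_mult geometric_deriv_sums geometric_sums) auto
  moreover have "2 * x * (1 / (1 - x)\<^sup>2) - x * (1 / (1 - x)) = x * (1 + x) / (1 - x)\<^sup>2"
  proof -
    have "1 - x \<noteq> 0" using assms by auto
    then have "x * (1 / (1 - x)) = x * (1 - x) / (1 - x)\<^sup>2" by (simp add: power2_eq_square)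
    then show ?thesis by (simp add: diff_divide_distrib[symmetric] algebra_simps)
  qed
  ultimately show ?thesis by (simp add: algebra_simps)
qed

text \<open>An infinite supremum satisfies the bound trivially. A finite one bounds every partial
  sum, hence the series at \<open>exp (-\<epsilon>)\<close>.\<close>

lemma dp_sup_loss_ge:
  assumes "\<epsilon> > 0" "dp_estimator \<epsilon> M"
  shows "ennreal (exp (-\<epsilon>) * (1 + exp (-\<epsilon>)) / (1 - exp (-\<epsilon>))\<^sup>2)
    \<le> (SUP D\<in>datasets. mean_sq_loss M (moment k) D)" (is "_ \<le> ?V")
proof (cases ?V rule: ennreal_cases)
  case (real v)
  let ?x = "exp (-\<epsilon>)"
  have le: "mean_sq_loss M (moment k) (replicate_mset n 1) \<le> ennreal v" if "n \<ge> 1" for n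
    using that unfolding real(2)[symmetric] by (intro SUP_upper) (auto simp: datasets_def)
  have "(\<lambda>m. (2 * real (Suc m) - 1) * ?x ^ Suc m) sums (?x * (1 + ?x) / (1 - ?x)\<^sup>2)"
    using assms(1) by (intro sums_odd_times_power) auto
  then have "(\<lambda>K. \<Sum>m<K. (2 * real (Suc m) - 1) * ?x ^ Suc m) \<longlonglongrightarrow> ?x * (1 + ?x) / (1 - ?x)\<^sup>2"
    by (simp add: sums_def)
  moreover have "(\<Sum>m<K. (2 * real (Suc m) - 1) * ?x ^ Suc m) \<le> v" for K
  proof -
    have "(\<Sum>m<K. (2 * real (Suc m) - 1) * ?x ^ Suc m) = (\<Sum>m=1..K. (2 * real m - 1) * exp (- \<epsilon> * real m))"
      by (rule sum.reindex_bij_witness[of _ "\<lambda>m. m - 1" Suc])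
         (auto simp: exp_of_nat_mult[symmetric] exp_add[symmetric] algebra_simps)
    then show ?thesis using sup_loss_ge_partial_sum[OF assms(2) le real(1)] by simp
  qed
  ultimately have "?x * (1 + ?x) / (1 - ?x)\<^sup>2 \<le> v"
    by (intro LIMSEQ_le_const2) auto
  then show ?thesis using real by (simp add: ennreal_leI)
next
  case top
  show ?thesis unfolding top by simp
qed

lemma dp_minimax_lower_bound:
  "\<exists>r :: real \<Rightarrow> real. r \<in> o[at_right 0](\<lambda>_. 1) \<and>
     (\<forall>\<^sub>F \<epsilon> in at_right 0. ennreal (2 / \<epsilon>\<^sup>2 * (1 - r \<epsilon>)) \<le>
        (INF M\<in>{M. dp_estimator \<epsilon> M}. SUP D\<in>datasets. mean_sq_loss M (moment k) D))"
proof (intro exI conjI)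
  \<comment> \<open>\<open>?r\<close> is the relative gap that makes the claimed bound equal to the
    closed form. As \<epsilon> decreases to 0, the numerator tends to 2 and the denominator is
    asymptotic to \<open>\<epsilon>\<^sup>2\<close>, so the gap vanishes.\<close>
  let ?r = "\<lambda>\<epsilon>::real. 1 - \<epsilon>\<^sup>2 / 2 * (exp (-\<epsilon>) * (1 + exp (-\<epsilon>)) / (1 - exp (-\<epsilon>))\<^sup>2)"
  show "?r \<in> o[at_right 0](\<lambda>_. 1)" by real_asymp
  show "\<forall>\<^sub>F \<epsilon> in at_right 0. ennreal (2 / \<epsilon>\<^sup>2 * (1 - ?r \<epsilon>)) \<le>
        (INF M\<in>{M. dp_estimator \<epsilon> M}. SUP D\<in>datasets. mean_sq_loss M (moment k) D)"
    using eventually_at_right_less[of 0]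
  proof eventually_elim
    case (elim \<epsilon>)
    then have "2 / \<epsilon>\<^sup>2 * (1 - ?r \<epsilon>) = exp (-\<epsilon>) * (1 + exp (-\<epsilon>)) / (1 - exp (-\<epsilon>))\<^sup>2" by simp
    then show ?case using dp_sup_loss_ge[OF elim] by (auto intro!: INF_greatest)
  qed
qed
theorem theorem2:
  fixes k :: nat
  assumes "k \<ge> 1"
  shows "(\<forall>\<epsilon>::real. \<epsilon> > 0 \<longrightarrow> (\<forall>D\<in>datasets.
            (\<forall>j\<le>k.
               mean_sq_loss (bezier_estimator k \<epsilon> j) (moment j) D =
                 ennreal (2 / (\<epsilon>\<^sup>2 * (real (k choose j))\<^sup>2) * (\<Sum>l=j..k. (real (l choose j))\<^sup>2)) \<and>
               (j \<ge> 1 \<longrightarrow>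
                 2 / (\<epsilon>\<^sup>2 * (real (k choose j))\<^sup>2) * (\<Sum>l=j..k. (real (l choose j))\<^sup>2)
                   \<le> 2 * real k / \<epsilon>\<^sup>2)) \<and>
            mean_sq_loss (bezier_estimator k \<epsilon> k) (moment k) D = ennreal (2 / \<epsilon>\<^sup>2))) \<and>
         (\<exists>r :: real \<Rightarrow> real. r \<in> o[at_right 0](\<lambda>_. 1) \<and>
            (\<forall>\<^sub>F \<epsilon> in at_right 0.
               ennreal (2 / \<epsilon>\<^sup>2 * (1 - r \<epsilon>)) \<le>
                 (INF M\<in>{M. dp_estimator \<epsilon> M}. SUP D\<in>datasets. mean_sq_loss M (moment k) D)))"
proof (intro conjI allI ballI impI)
  fix \<epsilon> :: real and D assume "\<epsilon> > 0"
  then show "mean_sq_loss (bezier_estimator k \<epsilon> k) (moment k) D = ennreal (2 / \<epsilon>\<^sup>2)"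
    \<comment> \<open>For \<open>j = k\<close> the sum has the single term \<open>l = k\<close>, and
      both binomial coefficients are 1.\<close>
    using mean_sq_loss_bezier_estimator[of \<epsilon> k k D] by simp
qed (rule mean_sq_loss_bezier_estimator bezier_loss_le dp_minimax_lower_bound; assumption)+

end
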